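(* Let $\Sigma_i$ be a simplicial fan in $\mathbb{R}^{d_i}$ with ray matrix $U_i\in\mathbb{R}^{n_i\times d_i}$, for $i=1,2$. The product fan $\Sigma=\Sigma_1\times\Sigma_2$ satisfies $${\rm Amp}_{\Sigma,U_1\oplus U_2}={\rm Amp}_{\Sigma_1,U_1}\cdot{\rm Amp}_{\Sigma_2,U_2}\quad\text{and}\quad{\rm Adj}_{\Sigma,U_1\oplus U_2}={\rm Adj}_{\Sigma_1,U_1}\cdot{\rm Adj}_{\Sigma_2,U_2}.$$ For full-dimensional simple polytopes $P_1\subset\mathbb{R}^{d_1}$, $P_2\subset\mathbb{R}^{d_2}$ with normal fans having ray matrices $U_1,U_2$, we have $${\rm Amp}_{P_1\times P_2,U_1\oplus U_2}={\rm Amp}_{P_1,U_1}\cdot{\rm Amp}_{P_2,U_2}\quad\text{and}\quad{\rm Adj}_{P_1\times P_2,U_1\oplus U_2}={\rm Adj}_{P_1,U_1}\cdot{\rm Adj}_{P_2,U_2}.$$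
   Context: A simplicial fan $\Sigma$ in $\mathbb{R}^d$ is a (finite) polyhedral fan whose cones are generated by linearly independent vectors. $\Sigma(k)$ is the set of $k$-dimensional cones, $\sigma(1)$ the set of rays of $\sigma$, $n=|\Sigma(1)|$. A ray matrix $U\in\mathbb{R}^{n\times d}$, assumed of rank $d$, has rows $u_\rho$, $\rho\in\Sigma(1)$, with $u_\rho$ a nonzero generator of $\rho$; $U_\sigma$ is the submatrix with rows indexed by $\sigma(1)$. The toric amplitude and universal adjoint are $${\rm Amp}_{\Sigma,U}(x)=\sum_{\sigma\in\Sigma(d)}\frac{|\det U_\sigma|}{\prod_{\rho\in\sigma(1)}x_\rho},\qquad{\rm Adj}_{\Sigma,U}(x)=\Big(\prod_{\rho\in\Sigma(1)}x_\rho\Big){\rm Amp}_{\Sigma,U}(x)=\sum_{\sigma\in\Sigma(d)}|\det U_\sigma|\prod_{\rho\notin\sigma(1)}x_\rho.$$ The product fan is $\Sigma_1\times\Sigma_2=\{\sigma_1\times\sigma_2:\sigma_i\in\Sigma_i\}$ in $\mathbb{R}^{d_1+d_2}$; its rays are $\rho\times\{0\}$, $\rho\in\Sigma_1(1)$, and $\{0\}\times\rho$, $\rho\in\Sigma_2(1)$, with ray matrix $U_1\oplus U_2=\begin{pmatrix}U_1&0\\0&U_2\end{pmatrix}\in\mathbb{R}^{(n_1+n_2)\times(d_1+d_2)}$. The variables for $\Sigma$ are the disjoint union of those for $\Sigma_1$ and $\Sigma_2$. For a full-dimensional simple polytope $P$ with inner normal fan $\Sigma_P$ and ray matrix $U$,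 ${\rm Amp}_{P,U}={\rm Amp}_{\Sigma_P,U}$ and ${\rm Adj}_{P,U}={\rm Adj}_{\Sigma_P,U}$. *)

theory Defs
  imports "HOL-Analysis.Analysis"
begin

definition polyhedral_cone :: "(real^'d) set \<Rightarrow> bool" where
  "polyhedral_cone \<sigma> \<longleftrightarrow> (\<exists>S. finite S \<and> \<sigma> = convex_cone hull S)"

definition simplicial_cone :: "(real^'d) set \<Rightarrow> bool" where
  "simplicial_cone \<sigma> \<longleftrightarrow> (\<exists>S. independent S \<and> \<sigma> = convex_cone hull S)"

text \<open>The empty set is a \<^const>\<open>face_of\<close> every set in HOL-Analysis, but it is not a cone;
  hence the nonemptiness condition.\<close>

definition polyhedral_fan :: "(real^'d) set set \<Rightarrow> bool" where
  "polyhedral_fan \<Sigma> \<longleftrightarrow>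
     finite \<Sigma> \<and>
     (\<forall>\<sigma>\<in>\<Sigma>. polyhedral_cone \<sigma>) \<and>
     (\<forall>\<sigma>\<in>\<Sigma>. \<forall>\<tau>. \<tau> face_of \<sigma> \<and> \<tau> \<noteq> {} \<longrightarrow> \<tau> \<in> \<Sigma>) \<and>
     (\<forall>\<sigma>\<in>\<Sigma>. \<forall>\<tau>\<in>\<Sigma>. (\<sigma> \<inter> \<tau>) face_of \<sigma> \<and> (\<sigma> \<inter> \<tau>) face_of \<tau>)"

definition simplicial_fan :: "(real^'d) set set \<Rightarrow> bool" where
  "simplicial_fan \<Sigma> \<longleftrightarrow> polyhedral_fan \<Sigma> \<and> (\<forall>\<sigma>\<in>\<Sigma>. simplicial_cone \<sigma>)"

definition cones_of_dim :: "(real^'d) set set \<Rightarrow> nat \<Rightarrow> (real^'d) set set" where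
  "cones_of_dim \<Sigma> k = {\<sigma> \<in> \<Sigma>. dim \<sigma> = k}"

definition cone_rays :: "(real^'d) set \<Rightarrow> (real^'d) set set" where
  "cone_rays \<sigma> = {\<rho>. \<rho> face_of \<sigma> \<and> dim \<rho> = 1}"

text \<open>The index type \<open>'n\<close> of the rows labels the rays: row \<open>i\<close> generates the ray
  \<open>row_ray U i\<close>, and \<open>i \<mapsto> row_ray U i\<close> is a bijection onto the set of rays of the fan
  (so \<open>CARD('n)\<close> is the number of rays). Rows are nonzero since \<open>row_ray U i\<close> has dimension one.\<close>

definition row_ray :: "real^'d^'n \<Rightarrow> 'n \<Rightarrow> (real^'d) set" where
  "row_ray U i = convex_cone hull {row i U}"

definition is_ray_matrix :: "(real^'d) set set \<Rightarrow> real^'d^'n \<Rightarrow> bool" where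
  "is_ray_matrix \<Sigma> U \<longleftrightarrow>
     bij_betw (row_ray U) UNIV (cones_of_dim \<Sigma> 1) \<and> rank U = CARD('d)"

definition ray_indices :: "real^'d^'n \<Rightarrow> (real^'d) set \<Rightarrow> 'n set" where
  "ray_indices U \<sigma> = {i. row_ray U i \<in> cone_rays \<sigma>}"

text \<open>\<open>|det U\<^sub>I|\<close> for the square submatrix on the rows in \<open>I\<close>, where \<open>card I = CARD('d)\<close>.
  The rows are enumerated by an arbitrary bijection \<open>e\<close>; by the lemma \<open>abs_minor_eq\<close>
  below, the choice does not matter.\<close>

definition abs_minor :: "real^'d^'n \<Rightarrow> 'n set \<Rightarrow> real" where
  "abs_minor U I =
     (let e = (SOME e. bij_betw e (UNIV :: 'd set) I) in \<bar>det (\<chi> k. row (e k) U)\<bar>)"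

lemma abs_minor_eq:
  fixes U :: "real^'d^'n"
  assumes e: "bij_betw e (UNIV :: 'd set) I"
  shows "abs_minor U I = \<bar>det (\<chi> k. row (e k) U)\<bar>"
proof -
  define f where "f = (SOME e. bij_betw e (UNIV :: 'd set) I)"
  have f: "bij_betw f UNIV I"
    unfolding f_def by (rule someI[of _ e]) (rule e)
  define p where "p = inv_into UNIV f \<circ> e"
  have p: "bij_betw p UNIV UNIV"
    unfolding p_def by (rule bij_betw_trans[OF e bij_betw_inv_into[OF f]])
  then have perm: "p permutes UNIV"
    by (intro bij_imp_permutes) auto
  have fp: "f (p k) = e k" for k
    using f e unfolding p_def by (auto simp: bij_betw_def intro!: f_inv_into_f)
  let ?A = "(\<chi> k. row (f k) U) :: real^'d^'d"
  have eq: "(\<chi> k. row (e k) U) = (\<chi> k. ?A $ p k)"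
    by (simp add: vec_eq_iff fp)
  have "\<bar>det (\<chi> k. ?A $ p k)\<bar> = \<bar>det ?A\<bar>"
    unfolding det_permute_rows[OF perm] by (simp add: abs_mult sign_def)
  then show ?thesis
    unfolding eq by (simp add: abs_minor_def f_def[symmetric])
qed

text \<open>The indeterminates are evaluated in an arbitrary field extending the reals. Equality of
  rational functions is equality of values where all \<open>x i \<noteq> 0\<close>; for other
  \<open>x\<close>, the value of \<open>Amp\<close> is determined by the convention \<open>a / 0 = 0\<close>.\<close>

definition Amp :: "(real^'d) set set \<Rightarrow> real^'d^'n \<Rightarrow> ('n \<Rightarrow> 'k::real_field) \<Rightarrow> 'k" where
  "Amp \<Sigma> U x =
     (\<Sum>\<sigma>\<in>cones_of_dim \<Sigma> CARD('d).
        of_real (abs_minor U (ray_indices U \<sigma>)) / (\<Prod>i\<in>ray_indices U \<sigma>. x i))"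

definition Adj :: "(real^'d) set set \<Rightarrow> real^'d^'n \<Rightarrow> ('n \<Rightarrow> 'k::real_field) \<Rightarrow> 'k" where
  "Adj \<Sigma> U x =
     (\<Sum>\<sigma>\<in>cones_of_dim \<Sigma> CARD('d).
        of_real (abs_minor U (ray_indices U \<sigma>)) * (\<Prod>i\<in>- ray_indices U \<sigma>. x i))"

lemma Adj_eq_prod_times_Amp:
  assumes "\<And>i. x i \<noteq> 0"
  shows "Adj \<Sigma> U x = (\<Prod>i\<in>UNIV. x i) * Amp \<Sigma> U x"
proof -
  have "(\<Prod>i\<in>UNIV. x i) = (\<Prod>i\<in>- I. x i) * (\<Prod>i\<in>I. x i)" for I
    using prod.subset_diff[of I UNIV x] by (simp add: Compl_eq_Diff_UNIV)
  then have "(\<Prod>i\<in>- I. x i) = (\<Prod>i\<in>UNIV. x i) / (\<Prod>i\<in>I. x i)" for I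
    using assms by (simp add: field_simps)
  then show ?thesis
    by (simp add: Adj_def Amp_def sum_distrib_left mult.commute)
qed

text \<open>The space of dimension \<open>d\<^sub>1 + d\<^sub>2\<close> is \<open>real^('a + 'b)\<close>.\<close>

definition join_vec :: "real^'a \<Rightarrow> real^'b \<Rightarrow> real^('a + 'b)" where
  "join_vec v w = (\<chi> k. case k of Inl i \<Rightarrow> v $ i | Inr j \<Rightarrow> w $ j)"

definition prod_set :: "(real^'a) set \<Rightarrow> (real^'b) set \<Rightarrow> (real^('a + 'b)) set" where
  "prod_set S T = {join_vec v w | v w. v \<in> S \<and> w \<in> T}"

definition prod_fan ::
  "(real^'a) set set \<Rightarrow> (real^'b) set set \<Rightarrow> (real^('a + 'b)) set set" where
  "prod_fan \<Sigma>\<^sub>1 \<Sigma>\<^sub>2 = {prod_set \<sigma>\<^sub>1 \<sigma>\<^sub>2 | \<sigma>\<^sub>1 \<sigma>\<^sub>2. \<sigma>\<^sub>1 \<in> \<Sigma>\<^sub>1 \<and> \<sigma>\<^sub>2 \<in> \<Sigma>\<^sub>2}"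

definition block_diag :: "real^'a^'m \<Rightarrow> real^'b^'n \<Rightarrow> real^('a + 'b)^('m + 'n)" where
  "block_diag U V =
     (\<chi> r. case r of Inl i \<Rightarrow> join_vec (row i U) 0 | Inr j \<Rightarrow> join_vec 0 (row j V))"

definition full_dim_simple_polytope :: "(real^'d) set \<Rightarrow> bool" where
  "full_dim_simple_polytope P \<longleftrightarrow>
     polytope P \<and> aff_dim P = int CARD('d) \<and>
     (\<forall>v. v extreme_point_of P \<longrightarrow> card {F. F facet_of P \<and> v \<in> F} = CARD('d))"

definition inner_normal_cone :: "(real^'d) set \<Rightarrow> (real^'d) set \<Rightarrow> (real^'d) set" where
  "inner_normal_cone P F = {y. \<forall>p\<in>F. \<forall>q\<in>P. y \<bullet> p \<le> y \<bullet> q}"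

definition normal_fan :: "(real^'d) set \<Rightarrow> (real^'d) set set" where
  "normal_fan P = {inner_normal_cone P F | F. F face_of P \<and> F \<noteq> {}}"

definition polytope_Amp :: "(real^'d) set \<Rightarrow> real^'d^'n \<Rightarrow> ('n \<Rightarrow> 'k::real_field) \<Rightarrow> 'k" where
  "polytope_Amp P U = Amp (normal_fan P) U"

definition polytope_Adj :: "(real^'d) set \<Rightarrow> real^'d^'n \<Rightarrow> ('n \<Rightarrow> 'k::real_field) \<Rightarrow> 'k" where
  "polytope_Adj P U = Adj (normal_fan P) U"

end

theory Submission
  imports Defs
begin

text \<open>The full-dimensional cones of the product fan are the products of full-dimensional cones. Since
  \<open>{0}\<close> is a face of every cone involved, the rays of \<open>\<sigma> \<times> \<tau>\<close> are those of \<open>\<sigma>\<close> together with those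
  of \<open>\<tau>\<close>, so the minor of \<open>U\<^sub>1 \<oplus> U\<^sub>2\<close> is block diagonal and factors, and the sums over cones
  multiply out. This needs each full-dimensional cone to have exactly \<open>d\<close> rays. For simplicial fans that
  is linear algebra. For polytopes, the normal fan of a product is the product of the normal fans, and
  at a vertex of a simple polytope the \<open>d\<close> facet normals form a basis generating the normal cone.\<close>

subsection \<open>Minors of block diagonal matrices\<close>

text \<open>In the Leibniz formula only permutations supported on the range of \<open>f\<close> contribute.\<close>

lemma det_identity_outside_range:
  fixes M :: "real^'c^'c" and f :: "'a::finite \<Rightarrow> 'c"
  assumes f: "inj f" and M: "\<And>k l. k \<notin> range f \<Longrightarrow> M $ k $ l = (if k = l then 1 else 0)"
  shows "det M = det (\<chi> i j. M $ f i $ f j)"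
proof -
  have bij: "bij_betw f UNIV (range f)"
    using f by (simp add: bij_betw_def)
  \<comment> \<open>\<open>map_permutation UNIV f\<close> transports a permutation along
    \<open>f\<close> and extends it by the identity off \<open>range f\<close>, matching
    permutations of the smaller index type with the surviving Leibniz terms.\<close>
  have bijp: "bij_betw (map_permutation UNIV f) {p. p permutes UNIV} {p. p permutes range f}"
    using bij_betw_permutations[OF bij]
    by (simp add: map_permutation_def[abs_def] restrict_id_def[abs_def] o_def)
  have "det M = (\<Sum>p\<in>{p. p permutes range f}. of_int (sign p) * (\<Prod>k\<in>UNIV. M $ k $ p k))"
    unfolding det_def
  proof (rule sum.mono_neutral_right)
    show "finite {p :: 'c \<Rightarrow> 'c. p permutes UNIV}"
      by simp
    show "{p. p permutes range f} \<subseteq> {p. p permutes UNIV}"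
      using permutes_subset by blast
    show "\<forall>p\<in>{p. p permutes UNIV} - {p. p permutes range f}.
            of_int (sign p) * (\<Prod>k\<in>UNIV. M $ k $ p k) = 0"
    proof
      fix p assume p: "p \<in> {p. p permutes UNIV} - {p. p permutes range f}"
      then obtain k where "k \<notin> range f" "p k \<noteq> k"
        using permutes_superset[of p UNIV "range f"] by auto
      then have "M $ k $ p k = 0"
        using M by auto
      then show "of_int (sign p) * (\<Prod>k\<in>UNIV. M $ k $ p k) = 0"
        by (auto simp: prod_zero_iff)
    qed
  qed
  also have "\<dots> = (\<Sum>p | p permutes UNIV. of_int (sign (map_permutation UNIV f p)) *
                    (\<Prod>k\<in>UNIV. M $ k $ map_permutation UNIV f p k))"
    by (rule sum.reindex_bij_betw[OF bijp, symmetric])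
  also have "\<dots> = (\<Sum>p | p permutes UNIV. of_int (sign p) * (\<Prod>i\<in>UNIV. M $ f i $ f (p i)))"
  proof (intro sum.cong refl, clarify)
    fix p :: "'a \<Rightarrow> 'a" assume p: "p permutes UNIV"
    have q: "map_permutation UNIV f p permutes range f"
      by (rule map_permutation_permutes[OF bij p])
    \<comment> \<open>Off \<open>range f\<close> the extended permutation fixes \<open>k\<close>, so
      the factor is a diagonal entry equal to 1.\<close>
    have "(\<Prod>k\<in>UNIV. M $ k $ map_permutation UNIV f p k)
        = (\<Prod>k\<in>range f. M $ k $ map_permutation UNIV f p k)"
      using M q by (intro prod.mono_neutral_right) (auto simp: permutes_def)
    also have "\<dots> = (\<Prod>i\<in>UNIV. M $ f i $ f (p i))"
      by (subst prod.reindex[OF f]) (simp add: map_permutation_apply[OF f])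
    finally show "of_int (sign (map_permutation UNIV f p)) * (\<Prod>k\<in>UNIV. M $ k $ map_permutation UNIV f p k)
        = of_int (sign p) * (\<Prod>i\<in>UNIV. M $ f i $ f (p i))"
      using sign_map_permutation[OF f p finite] by simp
  qed
  finally show ?thesis
    by (simp add: det_def)
qed

section \<open>Block matrices indexed by sum types\<close>

lemma sum_Plus_UNIV:
  "(\<Sum>k\<in>(UNIV :: ('a::finite + 'b::finite) set). f k) = (\<Sum>i\<in>UNIV. f (Inl i)) + (\<Sum>j\<in>UNIV. f (Inr j))"
  using sum.Plus[of UNIV UNIV f] by (simp add: UNIV_Plus_UNIV o_def)

lemma join_vec_nth [simp]:
  "join_vec v w $ Inl i = v $ i" "join_vec v w $ Inr j = w $ j"
  by (simp_all add: join_vec_def)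

lemma join_vec_ext:
  assumes "\<And>i. x $ Inl i = y $ Inl i" "\<And>j. x $ Inr j = y $ Inr j"
  shows "x = y"
  unfolding vec_eq_iff using assms by (metis sum.exhaust)

lemma block_diag_nth [simp]:
  "block_diag U V $ Inl i = join_vec (U $ i) 0" "block_diag U V $ Inr j = join_vec 0 (V $ j)"
  by (simp_all add: block_diag_def row_def)

lemma block_diag_mult:
  fixes A A' :: "real^'a^'a" and B B' :: "real^'b^'b"
  shows "block_diag A B ** block_diag A' B' = block_diag (A ** A') (B ** B')"
  by (intro join_vec_ext) (simp_all add: matrix_matrix_mult_def sum_Plus_UNIV)

text \<open>The matrix is the product of \<open>block_diag A (mat 1)\<close> and
  \<open>block_diag (mat 1) B\<close>. Each factor has unit rows outside one block, so its
  determinant reduces to that block.\<close>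

lemma det_block_diag:
  fixes A :: "real^'a^'a" and B :: "real^'b^'b"
  shows "det (block_diag A B) = det A * det B"
proof -
  have "det (block_diag A (mat 1 :: real^'b^'b)) = det A"
  proof (subst det_identity_outside_range[where f = Inl])
    fix k l :: "'a + 'b"
    assume "k \<notin> range Inl"
    then obtain j where "k = Inr j" by (cases k) auto
    then show "block_diag A (mat 1) $ k $ l = (if k = l then 1 else 0)"
      by (cases l) (simp_all add: mat_def)
  qed simp_all
  moreover have "det (block_diag (mat 1 :: real^'a^'a) B) = det B"
  proof (subst det_identity_outside_range[where f = Inr])
    fix k l :: "'a + 'b"
    assume "k \<notin> range Inr"
    then obtain i where "k = Inl i" by (cases k) auto
    then show "block_diag (mat 1) B $ k $ l = (if k = l then 1 else 0)"
      by (cases l) (simp_all add: mat_def)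
  qed simp_all
  moreover have "block_diag A B = block_diag A (mat 1) ** block_diag (mat 1) B"
    by (simp add: block_diag_mult)
  ultimately show ?thesis
    by (simp add: det_mul)
qed

text \<open>The cardinalities guarantee enumerations of \<open>I\<close> and \<open>J\<close>.
  Together these enumerate \<open>I <+> J\<close>, and since the enumeration does not affect an
  absolute minor, the submatrix may be taken block diagonal.\<close>

lemma abs_minor_block_diag:
  fixes U :: "real^'a^'m" and V :: "real^'b^'n"
  assumes "card I = CARD('a)" and "card J = CARD('b)"
  shows "abs_minor (block_diag U V) (I <+> J) = abs_minor U I * abs_minor V J"
proof -
  obtain e f where e: "bij_betw e (UNIV :: 'a set) I" and f: "bij_betw f (UNIV :: 'b set) J"
    using assms by (metis finite finite_same_card_bij)
  have ef: "bij_betw (map_sum e f) UNIV (I <+> J)"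
    unfolding bij_betw_def
  proof
    show "inj (map_sum e f)"
      using e f by (simp add: sum.inj_map bij_betw_def)
    show "range (map_sum e f) = I <+> J"
      using e f by (auto simp: bij_betw_def UNIV_sum image_Un image_image)
  qed
  have "(\<chi> k. row (map_sum e f k) (block_diag U V)) = block_diag (\<chi> k. row (e k) U) (\<chi> k. row (f k) V)"
    by (intro join_vec_ext) (simp_all add: row_def)
  then show ?thesis
    by (simp add: abs_minor_eq[OF e] abs_minor_eq[OF f] abs_minor_eq[OF ef] det_block_diag abs_mult)
qed

subsection \<open>Products of sets and fans\<close>

lemma linear_join_vec: "linear (\<lambda>(v, w). join_vec v w)"
  by (rule linearI) (auto intro!: join_vec_ext)

lemma inj_join_vec: "inj (\<lambda>(v, w). join_vec v w)"
  by (rule injI) (auto simp: vec_eq_iff, metis join_vec_nth(1), metis join_vec_nth(2))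

lemma join_vec_eq_iff [simp]: "join_vec v w = join_vec v' w' \<longleftrightarrow> v = v' \<and> w = w'"
  using inj_join_vec by (auto dest!: injD[where x = "(v, w)" and y = "(v', w')"])

lemma join_vec_cases: obtains v w where "x = join_vec v w"
  by (rule that[of "\<chi> i. x $ Inl i" "\<chi> j. x $ Inr j"]) (auto intro!: join_vec_ext)

lemma inner_join_vec: "join_vec v w \<bullet> join_vec v' w' = v \<bullet> v' + w \<bullet> w'"
  by (simp add: inner_vec_def sum_Plus_UNIV)

text \<open>Bridge to Cartesian products, whose dimension and faces are known and carry over along
  the injective linear map.\<close>

lemma prod_set_eq_image: "prod_set S T = (\<lambda>(v, w). join_vec v w) ` (S \<times> T)"
  by (auto simp: prod_set_def)

lemma join_vec_in_prod_set [simp]: "join_vec v w \<in> prod_set S T \<longleftrightarrow> v \<in> S \<and> w \<in> T"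
  by (auto simp: prod_set_def)

lemma prod_set_eq_iff:
  assumes "S \<noteq> {}" "T \<noteq> {}"
  shows "prod_set S T = prod_set S' T' \<longleftrightarrow> S = S' \<and> T = T'"
  unfolding prod_set_eq_image inj_image_eq_iff[OF inj_join_vec] using assms by (auto simp: times_eq_iff)

text \<open>Zero in both sets places copies of \<open>S\<close> and \<open>T\<close> inside the
  product, so the span of the product is the product of the spans.\<close>

lemma dim_prod_set:
  assumes "0 \<in> S" "0 \<in> T"
  shows "dim (prod_set S T) = dim S + dim T"
proof -
  have "span (S \<times> T) = span S \<times> span T"
  proof
    show "span (S \<times> T) \<subseteq> span S \<times> span T"
      by (intro span_minimal subspace_Times subspace_span) (auto intro: span_base)
    have "(v, 0) \<in> span (S \<times> T)" if "v \<in> span S" for v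
    proof -
      have "(\<lambda>v. (v, 0)) ` span S = span ((\<lambda>v. (v, 0)) ` S)"
        by (rule linear_span_image[symmetric]) (auto intro!: linearI)
      also have "\<dots> \<subseteq> span (S \<times> T)"
        using assms by (intro span_mono) auto
      finally show ?thesis using that by auto
    qed
    moreover have "(0, w) \<in> span (S \<times> T)" if "w \<in> span T" for w
    proof -
      have "(\<lambda>w. (0, w)) ` span T = span ((\<lambda>w. (0, w)) ` T)"
        by (rule linear_span_image[symmetric]) (auto intro!: linearI)
      also have "\<dots> \<subseteq> span (S \<times> T)"
        using assms by (intro span_mono) auto
      finally show ?thesis using that by auto
    qed
    ultimately show "span S \<times> span T \<subseteq> span (S \<times> T)"
      using span_add by fastforce
  qed
  then have "dim (S \<times> T) = dim (span S \<times> span T)"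
    by (metis dim_span)
  then show ?thesis
    by (simp add: prod_set_eq_image dim_image_eq[OF linear_join_vec] inj_on_subset[OF inj_join_vec] dim_Times)
qed

text \<open>Nonemptiness matters: an empty factor makes the product empty, hence a face of every
  set, whatever the other factor is.\<close>

lemma face_of_prod_set_iff:
  assumes "F \<noteq> {}" "G \<noteq> {}"
  shows "prod_set F G face_of prod_set S T \<longleftrightarrow> F face_of S \<and> G face_of T"
  using assms by (simp add: prod_set_eq_image face_of_linear_image[OF linear_join_vec inj_join_vec] face_of_Times_eq)

lemma face_of_prod_set_decomp:
  "C face_of prod_set S T \<longleftrightarrow> (\<exists>F G. F face_of S \<and> G face_of T \<and> C = prod_set F G)"
proof -
  have "C face_of prod_set S T \<longleftrightarrow> (\<exists>D. D face_of (S \<times> T) \<and> C = (\<lambda>(v, w). join_vec v w) ` D)"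
    using faces_of_linear_image[OF linear_join_vec inj_join_vec, of "S \<times> T"]
    unfolding prod_set_eq_image by blast
  then show ?thesis
    by (auto simp: face_of_Times_decomp prod_set_eq_image)
qed


section \<open>Rays and amplitudes of product fans\<close>

lemma row_ray_block_diag:
  "row_ray (block_diag U V) (Inl i) = prod_set (row_ray U i) {0}"
  "row_ray (block_diag U V) (Inr j) = prod_set {0} (row_ray V j)"
proof -
  have "linear (\<lambda>v. join_vec v 0)" "linear (\<lambda>w. join_vec 0 w)"
    by (auto intro!: linearI join_vec_ext)
  note this[THEN convex_cone_hull_linear_image]
  from this(1)[of "{row i U}"] this(2)[of "{row j V}"]
  show "row_ray (block_diag U V) (Inl i) = prod_set (row_ray U i) {0}"
    "row_ray (block_diag U V) (Inr j) = prod_set {0} (row_ray V j)"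
    by (auto simp: row_ray_def prod_set_def block_diag_def row_def)
qed

text \<open>A row of \<open>U\<close> yields the ray \<rho> \<times> {0}, which is a face of the
  product exactly if \<rho> is a face of \<sigma> and {0} is a face of \<tau>. This is where
  pointedness enters; the factor {0} adds nothing to the dimension.\<close>

lemma ray_indices_block_diag:
  assumes "{0} face_of \<sigma>" and "{0} face_of \<tau>"
  shows "ray_indices (block_diag U V) (prod_set \<sigma> \<tau>) = ray_indices U \<sigma> <+> ray_indices V \<tau>"
proof (rule set_eqI)
  fix k
  have "row_ray U i \<noteq> {}" "0 \<in> row_ray U i" "row_ray V j \<noteq> {}" "0 \<in> row_ray V j" for i j
    by (simp_all add: row_ray_def convex_cone_hull_nonempty convex_cone_hull_contains_0)
  then show "k \<in> ray_indices (block_diag U V) (prod_set \<sigma> \<tau>) \<longleftrightarrow> k \<in> ray_indices U \<sigma> <+> ray_indices V \<tau>"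
    using assms
    by (cases k) (auto simp: ray_indices_def cone_rays_def row_ray_block_diag face_of_prod_set_iff dim_prod_set)
qed

text \<open>Dimensions add and each is bounded by that of its ambient space, so the sum is maximal
  only if both are. Injectivity holds because cones containing 0 are nonempty.\<close>

lemma bij_betw_cones_of_prod_fan:
  fixes \<Sigma>\<^sub>1 :: "(real^'a) set set" and \<Sigma>\<^sub>2 :: "(real^'b) set set"
  assumes "\<forall>\<sigma>\<in>\<Sigma>\<^sub>1. 0 \<in> \<sigma>" and "\<forall>\<sigma>\<in>\<Sigma>\<^sub>2. 0 \<in> \<sigma>"
  shows "bij_betw (\<lambda>(\<sigma>, \<tau>). prod_set \<sigma> \<tau>)
    (cones_of_dim \<Sigma>\<^sub>1 CARD('a) \<times> cones_of_dim \<Sigma>\<^sub>2 CARD('b)) (cones_of_dim (prod_fan \<Sigma>\<^sub>1 \<Sigma>\<^sub>2) CARD('a + 'b))"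
  unfolding bij_betw_def
proof
  have "\<sigma> \<noteq> {}" if "\<sigma> \<in> \<Sigma>\<^sub>1" for \<sigma> using assms that by auto
  moreover have "\<sigma> \<noteq> {}" if "\<sigma> \<in> \<Sigma>\<^sub>2" for \<sigma> using assms that by auto
  ultimately show "inj_on (\<lambda>(\<sigma>, \<tau>). prod_set \<sigma> \<tau>) (cones_of_dim \<Sigma>\<^sub>1 CARD('a) \<times> cones_of_dim \<Sigma>\<^sub>2 CARD('b))"
    by (auto simp: inj_on_def cones_of_dim_def prod_set_eq_iff)
  have "dim \<sigma> = CARD('a) \<and> dim \<tau> = CARD('b)"
    if "dim \<sigma> + dim \<tau> = CARD('a) + CARD('b)" for \<sigma> :: "(real^'a) set" and \<tau> :: "(real^'b) set"
    using that dim_subset_UNIV[of \<sigma>] dim_subset_UNIV[of \<tau>] by simp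
  then show "(\<lambda>(\<sigma>, \<tau>). prod_set \<sigma> \<tau>) ` (cones_of_dim \<Sigma>\<^sub>1 CARD('a) \<times> cones_of_dim \<Sigma>\<^sub>2 CARD('b))
      = cones_of_dim (prod_fan \<Sigma>\<^sub>1 \<Sigma>\<^sub>2) CARD('a + 'b)"
    using assms by (auto simp: cones_of_dim_def prod_fan_def dim_prod_set image_iff)
qed

text \<open>Common core of the fan and polytope statements, reduced to what both can supply: pointed
  cones, and exactly as many rays in a full-dimensional cone as the dimension.\<close>

lemma Amp_Adj_prod_fan:
  fixes U :: "real^'a^'m" and V :: "real^'b^'n" and x :: "'m + 'n \<Rightarrow> 'k::real_field"
  assumes pointed: "\<forall>\<sigma>\<in>\<Sigma>\<^sub>1. {0} face_of \<sigma>" "\<forall>\<sigma>\<in>\<Sigma>\<^sub>2. {0} face_of \<sigma>"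
    and card1: "\<forall>\<sigma>\<in>cones_of_dim \<Sigma>\<^sub>1 CARD('a). card (ray_indices U \<sigma>) = CARD('a)"
    and card2: "\<forall>\<sigma>\<in>cones_of_dim \<Sigma>\<^sub>2 CARD('b). card (ray_indices V \<sigma>) = CARD('b)"
  shows "Amp (prod_fan \<Sigma>\<^sub>1 \<Sigma>\<^sub>2) (block_diag U V) x = Amp \<Sigma>\<^sub>1 U (\<lambda>i. x (Inl i)) * Amp \<Sigma>\<^sub>2 V (\<lambda>j. x (Inr j))"
    and "Adj (prod_fan \<Sigma>\<^sub>1 \<Sigma>\<^sub>2) (block_diag U V) x = Adj \<Sigma>\<^sub>1 U (\<lambda>i. x (Inl i)) * Adj \<Sigma>\<^sub>2 V (\<lambda>j. x (Inr j))"
proof -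
  let ?W = "block_diag U V"
  have "\<forall>\<sigma>\<in>\<Sigma>\<^sub>1. 0 \<in> \<sigma>" "\<forall>\<sigma>\<in>\<Sigma>\<^sub>2. 0 \<in> \<sigma>"
    using pointed by (auto dest: face_of_imp_subset)
  note bij = bij_betw_cones_of_prod_fan[OF this]
  have ind: "ray_indices ?W (prod_set \<sigma> \<tau>) = ray_indices U \<sigma> <+> ray_indices V \<tau>"
    and minor: "abs_minor ?W (ray_indices U \<sigma> <+> ray_indices V \<tau>)
        = abs_minor U (ray_indices U \<sigma>) * abs_minor V (ray_indices V \<tau>)"
    if "\<sigma> \<in> cones_of_dim \<Sigma>\<^sub>1 CARD('a)" "\<tau> \<in> cones_of_dim \<Sigma>\<^sub>2 CARD('b)" for \<sigma> \<tau>
    using that pointed card1 card2 by (auto simp: cones_of_dim_def intro!: ray_indices_block_diag abs_minor_block_diag)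
  \<comment> \<open>For the adjoint, the rays missing from a product cone are those missing from
    each factor.\<close>
  have Compl_Plus: "- (I <+> J) = (- I) <+> (- J)" for I :: "'m set" and J :: "'n set"
    by auto (metis ComplI InlI InrI old.sum.exhaust)
  \<comment> \<open>The terms match for every \<open>x\<close>: dividing by a product is dividing by
    its factors in turn, also under the convention a / 0 = 0.\<close>
  show "Amp (prod_fan \<Sigma>\<^sub>1 \<Sigma>\<^sub>2) ?W x = Amp \<Sigma>\<^sub>1 U (\<lambda>i. x (Inl i)) * Amp \<Sigma>\<^sub>2 V (\<lambda>j. x (Inr j))"
    unfolding Amp_def sum.reindex_bij_betw[OF bij, symmetric] sum_product sum.cartesian_product
    by (intro sum.cong refl) (auto simp: ind minor prod.Plus o_def)
  show "Adj (prod_fan \<Sigma>\<^sub>1 \<Sigma>\<^sub>2) ?W x = Adj \<Sigma>\<^sub>1 U (\<lambda>i. x (Inl i)) * Adj \<Sigma>\<^sub>2 V (\<lambda>j. x (Inr j))"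
    unfolding Adj_def sum.reindex_bij_betw[OF bij, symmetric] sum_product sum.cartesian_product
    by (intro sum.cong refl) (auto simp: ind minor Compl_Plus prod.Plus o_def)
qed

subsection \<open>Rays of simplicial cones\<close>

lemma convex_cone_sum:
  assumes "convex_cone C" and "\<And>i. i \<in> I \<Longrightarrow> f i \<in> C"
  shows "sum f I \<in> C"
  using assms
  by (induction I rule: infinite_finite_induct) (auto simp: convex_cone_contains_0 convex_cone_add)

text \<open>Lets the dimension of a cone be read off its generators.\<close>

lemma span_convex_cone_hull: "span (convex_cone hull S) = span S"
  unfolding span_eq
  by (metis convex_cone_span hull_minimal hull_subset span_superset subset_trans)

lemma convex_cone_hull_singleton: "convex_cone hull {v} = {c *\<^sub>R v | c. 0 \<le> c}" (is "_ = ?C")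
proof (rule hull_unique)
  show "{v} \<subseteq> ?C"
    by (auto intro: exI[of _ 1])
  show "convex_cone ?C"
    unfolding convex_cone_iff by (auto simp: scaleR_add_left[symmetric] intro: exI[of _ 0])
  show "?C \<subseteq> T" if "{v} \<subseteq> T" "convex_cone T" for T
    using that by (auto intro: convex_cone_scaleR)
qed

text \<open>In the coordinates given by the basis \<open>S\<close> of its span, a simplicial cone is
  the nonnegative orthant. Linearity of coordinates makes the right side a cone; writing a point as
  the sum of its components shows minimality.\<close>

lemma convex_cone_hull_independent:
  fixes S :: "'a::euclidean_space set"
  assumes S: "independent S"
  shows "convex_cone hull S = {x \<in> span S. \<forall>s\<in>S. 0 \<le> representation S x s}" (is "_ = ?C")
proof (rule hull_unique)
  show "S \<subseteq> ?C"
    using S by (auto simp: span_base real_vector.representation_basis)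
  show "convex_cone ?C"
    using S by (auto simp: convex_cone_iff real_vector.representation_zero real_vector.representation_add
        real_vector.representation_scale span_add span_scale span_zero)
  fix T assume T: "S \<subseteq> T" "convex_cone T"
  show "?C \<subseteq> T"
  proof
    fix x assume x: "x \<in> ?C"
    have "(\<Sum>s\<in>S. representation S x s *\<^sub>R s) \<in> T"
      using T x by (intro convex_cone_sum) (auto intro: convex_cone_scaleR)
    then show "x \<in> T"
      using real_vector.sum_representation_eq[OF S, of x S] x S
      by (simp add: finiteI_independent)
  qed
qed

text \<open>Coordinates with respect to \<open>T\<close> agree with those with respect to
  \<open>S\<close> on the span of \<open>T\<close>, so the smaller cone is a coordinate slice of the
  orthant.\<close>

lemma convex_cone_hull_independent_subset:
  fixes S :: "'a::euclidean_space set"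
  assumes S: "independent S" and "T \<subseteq> S"
  shows "convex_cone hull T = {x \<in> convex_cone hull S. \<forall>s\<in>S - T. representation S x s = 0}"
proof -
  have T: "independent T"
    using assms independent_mono by blast
  have rep: "representation S x s = representation T x s" if "x \<in> span T" for x s
    using real_vector.representation_extend[OF S that \<open>T \<subseteq> S\<close>] by simp
  have "representation T x s = 0" if "s \<notin> T" for x s
    using that real_vector.representation_ne_zero by blast
  moreover have "x \<in> span T" if x: "x \<in> span S" "\<forall>s\<in>S - T. representation S x s = 0" for x
  proof -
    have "x = (\<Sum>s\<in>S. representation S x s *\<^sub>R s)"
      using real_vector.sum_representation_eq[OF S, of x S] x S by (simp add: finiteI_independent)
    also have "\<dots> = (\<Sum>s\<in>T. representation S x s *\<^sub>R s)"
      using x \<open>T \<subseteq> S\<close> S by (intro sum.mono_neutral_right) (auto simp: finiteI_independent)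
    also have "\<dots> \<in> span T"
      by (intro span_sum span_scale span_base)
    finally show ?thesis .
  qed
  ultimately show ?thesis
    using rep span_mono[OF \<open>T \<subseteq> S\<close>] \<open>T \<subseteq> S\<close>
    unfolding convex_cone_hull_independent[OF S] convex_cone_hull_independent[OF T] by (auto; metis)
qed

text \<open>If a positive combination of two points has vanishing coordinate at \<open>s\<close>,
  then both nonnegative coordinates vanish there.\<close>

lemma convex_cone_hull_face_of_simplicial:
  fixes S :: "'a::euclidean_space set"
  assumes S: "independent S" and "T \<subseteq> S"
  shows "(convex_cone hull T) face_of (convex_cone hull S)"
  unfolding face_of_def
proof (intro conjI ballI impI)
  show "convex_cone hull T \<subseteq> convex_cone hull S"
    using assms by (simp add: hull_mono)
  show "convex (convex_cone hull T)"
    by (rule convex_convex_cone_hull)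
  fix a b x
  assume ab: "a \<in> convex_cone hull S" "b \<in> convex_cone hull S" and x: "x \<in> convex_cone hull T"
    and "x \<in> open_segment a b"
  then obtain u where u: "0 < u" "u < 1" "x = (1 - u) *\<^sub>R a + u *\<^sub>R b"
    by (auto simp: in_segment)
  have "representation S a s = 0 \<and> representation S b s = 0" if s: "s \<in> S - T" for s
  proof -
    have "0 = (1 - u) * representation S a s + u * representation S b s"
      using x s ab u S unfolding convex_cone_hull_independent_subset[OF assms] convex_cone_hull_independent[OF S]
      by (auto simp: real_vector.representation_add real_vector.representation_scale span_scale)
    moreover have "0 \<le> (1 - u) * representation S a s" "0 \<le> u * representation S b s"
      using ab u s by (auto simp: convex_cone_hull_independent[OF S])
    ultimately have "(1 - u) * representation S a s = 0" "u * representation S b s = 0"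
      by linarith+
    then show ?thesis
      using u by auto
  qed
  then show "a \<in> convex_cone hull T" "b \<in> convex_cone hull T"
    using ab by (auto simp: convex_cone_hull_independent_subset[OF assms])
qed

text \<open>A face of a cone is conic, so it contains the midpoint of \<open>y\<close> and
  \<open>z\<close>, and the face property applies. The case \<open>y = z\<close> is separate since
  the open segment is then empty.\<close>

lemma face_of_convex_cone_summand:
  fixes \<rho> \<sigma> :: "'a::real_vector set"
  assumes "convex_cone \<sigma>" "\<rho> face_of \<sigma>" "y \<in> \<sigma>" "z \<in> \<sigma>" "y + z \<in> \<rho>"
  shows "y \<in> \<rho>"
proof -
  have "conic \<rho>"
    using assms(1,2) face_of_conic[of \<sigma> \<rho>] by (simp add: convex_cone_def)
  then have half: "(1/2) *\<^sub>R (y + z) \<in> \<rho>"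
    using assms by (intro conic_mul) auto
  show ?thesis
  proof (cases "y = z")
    case True
    then show ?thesis using half by (simp add: scaleR_half_double)
  next
    case False
    then have mid: "(1/2) *\<^sub>R (y + z) \<in> open_segment y z"
      by (auto simp: in_segment scaleR_add_right intro!: exI[of _ "1/2"])
    show ?thesis
      using face_ofD[OF assms(2) mid assms(3,4) half] by simp
  qed
qed

text \<open>A nonzero point of a ray has some positive coordinate, say at \<open>s\<close>.
  Splitting off that component keeps the remainder in the cone, so the ray contains
  \<open>s\<close>, and dimension one leaves room for nothing else.\<close>

lemma cone_rays_simplicial:
  fixes S :: "(real^'d) set"
  assumes S: "independent S"
  shows "cone_rays (convex_cone hull S) = (\<lambda>s. convex_cone hull {s}) ` S"
proof (intro equalityI subsetI)
  fix \<rho> assume "\<rho> \<in> (\<lambda>s. convex_cone hull {s}) ` S"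
  then obtain s where s: "s \<in> S" "\<rho> = convex_cone hull {s}"
    by auto
  have "s \<noteq> 0"
    using s S dependent_zero by blast
  then have "dim (convex_cone hull {s}) = 1"
    using span_eq_dim[OF span_convex_cone_hull, of "{s}"] by simp
  then show "\<rho> \<in> cone_rays (convex_cone hull S)"
    using s convex_cone_hull_face_of_simplicial[OF S, of "{s}"] by (simp add: cone_rays_def)
next
  fix \<rho> assume "\<rho> \<in> cone_rays (convex_cone hull S)"
  then have \<rho>: "\<rho> face_of convex_cone hull S" "dim \<rho> = 1"
    by (auto simp: cone_rays_def)
  then have conic: "conic \<rho>"
    using face_of_conic[OF conic_convex_cone_hull] by simp
  have sub: "\<rho> \<subseteq> convex_cone hull S"
    using \<rho> face_of_imp_subset by blast
  obtain x where x: "x \<in> \<rho>" "x \<noteq> 0"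
    using \<rho> by (metis dim_eq_0 insertCI subsetI zero_neq_one)
  show "\<rho> \<in> (\<lambda>s. convex_cone hull {s}) ` S"
  proof -
    have "x \<in> span S"
      using x sub by (auto simp: convex_cone_hull_independent[OF S])
    then have "(\<Sum>s\<in>S. representation S x s *\<^sub>R s) = x"
      using S by (simp add: real_vector.sum_representation_eq finiteI_independent)
    then obtain s where s: "s \<in> S" "representation S x s *\<^sub>R s \<noteq> 0"
      using x sum.not_neutral_contains_not_neutral[of "\<lambda>s. representation S x s *\<^sub>R s" S] by auto
    define c where "c = representation S x s"
    have "0 < c"
      using s x sub unfolding c_def by (auto simp: convex_cone_hull_independent[OF S] order_less_le)
    have sS: "s \<in> convex_cone hull S"
      using s by (simp add: hull_inc)
    have "s \<in> span S"
      using s by (simp add: span_base)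
    \<comment> \<open>Subtracting the component at \<open>s\<close> only sets that coordinate to
      zero, so the difference stays in the orthant.\<close>
    have "representation S (x - c *\<^sub>R s) r = (if r = s then 0 else representation S x r)" for r
      using S s(1) \<open>s \<in> span S\<close> \<open>x \<in> span S\<close>
      by (simp add: real_vector.representation_diff real_vector.representation_scale
          real_vector.representation_basis span_scale c_def)
    then have diff: "x - c *\<^sub>R s \<in> convex_cone hull S"
      using x(1) sub \<open>s \<in> span S\<close> \<open>x \<in> span S\<close>
      by (auto simp: convex_cone_hull_independent[OF S] span_diff span_scale)
    have "c *\<^sub>R s + (x - c *\<^sub>R s) \<in> \<rho>"
      using x by simp
    then have "c *\<^sub>R s \<in> \<rho>"
      by (rule face_of_convex_cone_summand[OF convex_cone_convex_cone_hull \<rho>(1) convex_cone_hull_mul[OF sS] diff, rotated])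
        (use \<open>0 < c\<close> in simp)
    then have "s \<in> \<rho>"
      using conic_mul[OF conic, of "c *\<^sub>R s" "1 / c"] \<open>0 < c\<close> by simp
    have "s \<noteq> 0"
      using s S dependent_zero by blast
    have "span {s} = span \<rho>"
      using \<open>s \<in> \<rho>\<close> \<open>s \<noteq> 0\<close> \<rho>(2) by (intro dim_eq_span) auto
    have "\<rho> \<subseteq> convex_cone hull {s}"
    proof
      fix u assume u: "u \<in> \<rho>"
      then obtain k where k: "u = k *\<^sub>R s"
        using \<open>span {s} = span \<rho>\<close> span_base[of u \<rho>] by (auto simp: span_singleton)
      then have "representation S u s = k"
        using s S by (simp add: real_vector.representation_scale real_vector.representation_basis span_base)
      then have "0 \<le> k"
        using u sub s by (auto simp: convex_cone_hull_independent[OF S])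
      then show "u \<in> convex_cone hull {s}"
        using k by (auto simp: convex_cone_hull_singleton)
    qed
    moreover have "convex_cone hull {s} \<subseteq> \<rho>"
      using conic \<open>s \<in> \<rho>\<close> by (auto simp: convex_cone_hull_singleton intro: conic_mul)
    ultimately have "\<rho> = convex_cone hull {s}"
      by (rule equalityI)
    then show ?thesis
      by (rule image_eqI[OF _ s(1)])
  qed
qed

text \<open>A generator \<open>t\<close> on the ray of another generator \<open>s\<close> would have
  vanishing coordinate at \<open>t\<close>, but that coordinate is 1.\<close>

lemma inj_on_convex_cone_hull_singleton:
  fixes S :: "'a::euclidean_space set"
  assumes S: "independent S"
  shows "inj_on (\<lambda>s. convex_cone hull {s}) S"
proof (rule inj_onI, rule ccontr)
  fix s t assume st: "s \<in> S" "t \<in> S" "convex_cone hull {s} = convex_cone hull {t}" "s \<noteq> t"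
  have "t \<in> convex_cone hull {s}"
    unfolding st(3) by (simp add: hull_inc)
  then have "\<forall>r\<in>S - {s}. representation S t r = 0"
    using convex_cone_hull_independent_subset[OF S, of "{s}"] st(1) by blast
  then have "representation S t t = 0"
    using st(2,4) by blast
  then show False
    by (simp add: real_vector.representation_basis[OF S st(2)])
qed

text \<open>Stated for generators rather than for a fan, so that it applies both to simplicial fans
  and to vertex cones of simple polytopes. Membership of the rays in \<Sigma> ensures that each is
  generated by a row of \<open>U\<close>.\<close>

lemma card_ray_indices_simplicial:
  fixes S :: "(real^'d) set" and U :: "real^'d^'n"
  assumes S: "independent S" and "\<And>s. s \<in> S \<Longrightarrow> convex_cone hull {s} \<in> \<Sigma>"
    and U: "bij_betw (row_ray U) UNIV (cones_of_dim \<Sigma> 1)"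
  shows "card (ray_indices U (convex_cone hull S)) = card S"
proof -
  have "cone_rays (convex_cone hull S) \<subseteq> range (row_ray U)"
    using assms cone_rays_simplicial[OF S] by (auto simp: bij_betw_def cones_of_dim_def cone_rays_def)
  then have "card (row_ray U -` cone_rays (convex_cone hull S)) = card (cone_rays (convex_cone hull S))"
    using U by (intro card_vimage_inj) (auto simp: bij_betw_def)
  also have "\<dots> = card S"
    unfolding cone_rays_simplicial[OF S] by (rule card_image[OF inj_on_convex_cone_hull_singleton[OF S]])
  finally show ?thesis
    by (simp add: ray_indices_def vimage_def)
qed

lemma simplicial_fan_pointed:
  assumes "simplicial_fan \<Sigma>" "\<sigma> \<in> \<Sigma>"
  shows "{0} face_of \<sigma>"
proof -
  have "simplicial_cone \<sigma>"
    using assms by (simp add: simplicial_fan_def)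
  then obtain S where "independent S" "\<sigma> = convex_cone hull S"
    unfolding simplicial_cone_def by blast
  then show ?thesis
    using convex_cone_hull_face_of_simplicial[of S "{}"] by simp
qed

text \<open>Closure of the fan under nonempty faces puts the rays of the cone into \<Sigma>;
  independence makes the number of generators equal to the dimension.\<close>

lemma simplicial_fan_card_ray_indices:
  fixes U :: "real^'d^'n"
  assumes \<Sigma>: "simplicial_fan \<Sigma>" and U: "is_ray_matrix \<Sigma> U" and \<sigma>: "\<sigma> \<in> cones_of_dim \<Sigma> k"
  shows "card (ray_indices U \<sigma>) = k"
proof -
  have "\<sigma> \<in> \<Sigma>" "dim \<sigma> = k"
    using \<sigma> by (auto simp: cones_of_dim_def)
  then have "simplicial_cone \<sigma>"
    using \<Sigma> by (simp add: simplicial_fan_def)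
  then obtain S where S: "independent S" "\<sigma> = convex_cone hull S"
    unfolding simplicial_cone_def by blast
  have "convex_cone hull {s} \<in> \<Sigma>" if "s \<in> S" for s
  proof -
    have "(convex_cone hull {s}) face_of \<sigma>" "convex_cone hull {s} \<noteq> {}"
      using S that convex_cone_hull_face_of_simplicial[of S "{s}"] by (simp_all add: convex_cone_hull_nonempty)
    then show ?thesis
      using \<Sigma> \<open>\<sigma> \<in> \<Sigma>\<close> unfolding simplicial_fan_def polyhedral_fan_def by blast
  qed
  then have "card (ray_indices U \<sigma>) = card S"
    unfolding S(2) using S(1) U card_ray_indices_simplicial[of S \<Sigma> U] by (simp add: is_ray_matrix_def)
  also have "\<dots> = dim \<sigma>"
    unfolding S(2) using span_eq_dim[OF span_convex_cone_hull, of S] dim_eq_card_independent[OF S(1)] by simp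
  finally show ?thesis
    using \<open>dim \<sigma> = k\<close> by simp
qed

subsection \<open>Normal fans of polytopes\<close>

lemma ball_prod_set: "(\<forall>z\<in>prod_set S T. Q z) \<longleftrightarrow> (\<forall>v\<in>S. \<forall>w\<in>T. Q (join_vec v w))"
  by (auto simp: prod_set_def)

lemma inner_normal_cone_prod_set:
  fixes P :: "(real^'a) set" and Q :: "(real^'b) set"
  assumes "F \<noteq> {}" "F \<subseteq> P" "G \<noteq> {}" "G \<subseteq> Q"
  shows "inner_normal_cone (prod_set P Q) (prod_set F G) = prod_set (inner_normal_cone P F) (inner_normal_cone Q G)"
proof (rule set_eqI)
  fix z :: "real^('a + 'b)"
  obtain y y' where z: "z = join_vec y y'"
    by (rule join_vec_cases)
  have "z \<in> inner_normal_cone (prod_set P Q) (prod_set F G) \<longleftrightarrow>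
      (\<forall>p\<in>F. \<forall>p'\<in>G. \<forall>q\<in>P. \<forall>q'\<in>Q. y \<bullet> p + y' \<bullet> p' \<le> y \<bullet> q + y' \<bullet> q')"
    by (simp add: z inner_normal_cone_def ball_prod_set inner_join_vec)
  also have "\<dots> \<longleftrightarrow> (\<forall>p\<in>F. \<forall>q\<in>P. y \<bullet> p \<le> y \<bullet> q) \<and> (\<forall>p'\<in>G. \<forall>q'\<in>Q. y' \<bullet> p' \<le> y' \<bullet> q')"
  proof (intro iffI conjI ballI)
    assume *: "\<forall>p\<in>F. \<forall>p'\<in>G. \<forall>q\<in>P. \<forall>q'\<in>Q. y \<bullet> p + y' \<bullet> p' \<le> y \<bullet> q + y' \<bullet> q'"
    \<comment> \<open>Base points lying in both the face and the polytope: inserting one of them on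
      both sides cancels the terms of that factor.\<close>
    obtain f g where "f \<in> F" "f \<in> P" "g \<in> G" "g \<in> Q"
      using assms by blast
    then show "y \<bullet> p \<le> y \<bullet> q" if "p \<in> F" "q \<in> P" for p q
      using *[rule_format, OF that(1) \<open>g \<in> G\<close> that(2) \<open>g \<in> Q\<close>] by simp
    show "y' \<bullet> p' \<le> y' \<bullet> q'" if "p' \<in> G" "q' \<in> Q" for p' q'
      using *[rule_format, OF \<open>f \<in> F\<close> that(1) \<open>f \<in> P\<close> that(2)] by simp
  qed (auto intro: add_mono)
  also have "\<dots> \<longleftrightarrow> z \<in> prod_set (inner_normal_cone P F) (inner_normal_cone Q G)"
    by (simp add: z inner_normal_cone_def)
  finally show "z \<in> inner_normal_cone (prod_set P Q) (prod_set F G) \<longleftrightarrow>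
      z \<in> prod_set (inner_normal_cone P F) (inner_normal_cone Q G)" .
qed

lemma prod_set_eq_empty_iff [simp]: "prod_set S T = {} \<longleftrightarrow> S = {} \<or> T = {}"
  by (auto simp: prod_set_eq_image)

lemma normal_fan_prod_set: "normal_fan (prod_set P Q) = prod_fan (normal_fan P) (normal_fan Q)"
proof
  show "normal_fan (prod_set P Q) \<subseteq> prod_fan (normal_fan P) (normal_fan Q)"
  proof
    fix \<sigma> assume "\<sigma> \<in> normal_fan (prod_set P Q)"
    then obtain K where K: "K face_of prod_set P Q" "K \<noteq> {}" "\<sigma> = inner_normal_cone (prod_set P Q) K"
      by (auto simp: normal_fan_def)
    then obtain F G where "F face_of P" "G face_of Q" "K = prod_set F G"
      by (auto simp: face_of_prod_set_decomp)
    with K have *: "F face_of P" "G face_of Q" "F \<noteq> {}" "G \<noteq> {}"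
        and "\<sigma> = inner_normal_cone (prod_set P Q) (prod_set F G)"
      by simp_all
    then have "\<sigma> = prod_set (inner_normal_cone P F) (inner_normal_cone Q G)"
      by (simp add: inner_normal_cone_prod_set face_of_imp_subset)
    then show "\<sigma> \<in> prod_fan (normal_fan P) (normal_fan Q)"
      using * by (auto simp: prod_fan_def normal_fan_def)
  qed
  show "prod_fan (normal_fan P) (normal_fan Q) \<subseteq> normal_fan (prod_set P Q)"
  proof
    fix \<sigma> assume "\<sigma> \<in> prod_fan (normal_fan P) (normal_fan Q)"
    then obtain F G where *: "F face_of P" "G face_of Q" "F \<noteq> {}" "G \<noteq> {}"
        and "\<sigma> = prod_set (inner_normal_cone P F) (inner_normal_cone Q G)"
      by (auto simp: normal_fan_def prod_fan_def)
    then have "\<sigma> = inner_normal_cone (prod_set P Q) (prod_set F G)"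
      by (simp add: inner_normal_cone_prod_set face_of_imp_subset)
    moreover have "prod_set F G face_of prod_set P Q" "prod_set F G \<noteq> {}"
      using * by (simp_all add: face_of_prod_set_iff)
    ultimately show "\<sigma> \<in> normal_fan (prod_set P Q)"
      unfolding normal_fan_def by blast
  qed
qed

section \<open>Cones in the normal fan of a full-dimensional polytope\<close>

lemma full_dim_inner_const_imp_zero:
  fixes P :: "'a::euclidean_space set"
  assumes "aff_dim P = int DIM('a)" and "\<And>q. q \<in> P \<Longrightarrow> y \<bullet> q = c"
  shows "y = 0"
proof (rule ccontr)
  assume "y \<noteq> 0"
  \<comment> \<open>Otherwise \<open>P\<close> lies in a hyperplane, whose affine dimension is one
    too small.\<close>
  have "aff_dim P \<le> aff_dim {x. y \<bullet> x = c}"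
    using assms(2) by (intro aff_dim_subset) auto
  then show False
    using \<open>y \<noteq> 0\<close> assms(1) by simp
qed

lemma convex_cone_inner_normal_cone: "convex_cone (inner_normal_cone P F)"
  unfolding convex_cone_iff inner_normal_cone_def
  by (auto simp: inner_add_left intro: add_mono mult_left_mono)

text \<open>If 0 lies strictly between \<open>a\<close> and \<open>b\<close>, then on each
  difference \<open>q - p\<close> two nonnegative terms sum to zero. So \<open>a\<close> is constant
  on \<open>P\<close> and vanishes by full dimension.\<close>

lemma normal_fan_pointed:
  fixes P :: "(real^'d) set"
  assumes P: "aff_dim P = int CARD('d)" and "\<sigma> \<in> normal_fan P"
  shows "{0} face_of \<sigma>"
proof -
  obtain F p where F: "\<sigma> = inner_normal_cone P F" "p \<in> F"
    using assms by (auto simp: normal_fan_def)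
  have "a = 0 \<and> b = 0" if ab: "a \<in> \<sigma>" "b \<in> \<sigma>" "0 \<in> open_segment a b" for a b
  proof -
    obtain u where u: "0 < u" "u < 1" "(1 - u) *\<^sub>R a + u *\<^sub>R b = 0"
      using ab by (auto simp: in_segment)
    have "a \<bullet> q = a \<bullet> p" if "q \<in> P" for q
    proof -
      have "(1 - u) * (a \<bullet> (q - p)) + u * (b \<bullet> (q - p)) = 0"
        using arg_cong[OF u(3), of "\<lambda>z. z \<bullet> (q - p)"] by (simp add: inner_add_left)
      moreover have "0 \<le> u * (b \<bullet> (q - p))" "0 \<le> (1 - u) * (a \<bullet> (q - p))"
        using ab F that u by (auto simp: inner_normal_cone_def inner_diff_right)
      ultimately have "(1 - u) * (a \<bullet> (q - p)) = 0"
        by linarith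
      then show ?thesis
        using u by (simp add: inner_diff_right)
    qed
    then have "a = 0"
      using P by (intro full_dim_inner_const_imp_zero[of P a]) auto
    then show ?thesis
      using u by simp
  qed
  moreover have "0 \<in> \<sigma>"
    using F by (simp add: inner_normal_cone_def)
  ultimately show ?thesis
    by (auto simp: face_of_def)
qed

text \<open>A functional minimal along the facet is constant on it, hence a multiple of
  \<open>a\<close>. The sign is negative because \<open>a\<close> points outward while the normal
  cone is inner.\<close>

lemma inner_normal_cone_facet:
  fixes P :: "(real^'d) set"
  assumes P: "aff_dim P = int CARD('d)" and C: "C facet_of P"
    and a: "a \<noteq> 0" "P \<subseteq> {x. a \<bullet> x \<le> b}" "C = P \<inter> {x. a \<bullet> x = b}"
  shows "inner_normal_cone P C = convex_cone hull {- a}"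
proof
  show "convex_cone hull {- a} \<subseteq> inner_normal_cone P C"
    using a by (intro hull_minimal convex_cone_inner_normal_cone) (auto simp: inner_normal_cone_def)
  show "inner_normal_cone P C \<subseteq> convex_cone hull {- a}"
  proof
    fix y assume "y \<in> inner_normal_cone P C"
    then have y: "y \<bullet> p \<le> y \<bullet> q" if "p \<in> C" "q \<in> P" for p q
      using that by (auto simp: inner_normal_cone_def)
    obtain p where p: "p \<in> C"
      using C by (auto simp: facet_of_def)
    define L where "L = (+) (- p) ` C"
    \<comment> \<open>\<open>L\<close> is the facet translated through the origin; by dimension it
      spans the hyperplane orthogonal to \<open>a\<close>.\<close>
    have "int (dim L) = int CARD('d) - 1"
      unfolding L_def using C P p aff_dim_eq_dim[of p C] by (simp add: facet_of_def hull_inc)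
    then have "dim L = CARD('d) - 1"
      by linarith
    then have "span L = span {x. a \<bullet> x = 0}"
      using a p by (intro dim_eq_span) (auto simp: L_def inner_diff_right dim_hyperplane)
    moreover have "y \<bullet> q = y \<bullet> p" if "q \<in> C" for q
      using y[of p q] y[of q p] p that a(3) by auto
    then have "span L \<subseteq> {x. y \<bullet> x = 0}"
      by (intro span_minimal subspace_hyperplane) (auto simp: L_def inner_diff_right)
    ultimately have perp: "y \<bullet> x = 0" if "a \<bullet> x = 0" for x
      using that span_base[of x "{x. a \<bullet> x = 0}"] by auto
    define c where "c = (y \<bullet> a) / (a \<bullet> a)"
    have "a \<bullet> (y - c *\<^sub>R a) = 0"
      using a(1) by (simp add: c_def inner_diff_right inner_commute)
    from perp[OF this] this have "(y - c *\<^sub>R a) \<bullet> (y - c *\<^sub>R a) = 0"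
      by (simp add: inner_diff_left inner_commute)
    then have yc: "y = c *\<^sub>R a"
      by simp
    \<comment> \<open>Full dimension provides a point off the facet hyperplane; comparing it with
      \<open>p\<close> fixes the sign of \<open>c\<close>.\<close>
    obtain q where q: "q \<in> P" "a \<bullet> q < b"
      using full_dim_inner_const_imp_zero[of P a b] P a by force
    have "c * b \<le> c * (a \<bullet> q)"
      using y[OF p q(1)] p a(3) by (simp add: yc)
    then have "c \<le> 0"
      using q(2) by (meson mult_less_cancel_left_pos not_le)
    then show "y \<in> convex_cone hull {- a}"
      unfolding convex_cone_hull_singleton by (auto simp: yc intro!: exI[of _ "- c"])
  qed
qed

text \<open>Tight constraints are not increased along \<open>w\<close>, and slack ones survive small
  steps by continuity.\<close>

lemma eventually_feasible_direction:
  fixes a :: "'i \<Rightarrow> 'a::real_inner"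
  assumes "finite H" and v: "\<And>h. h \<in> H \<Longrightarrow> a h \<bullet> v \<le> b h"
    and w: "\<And>h. h \<in> H \<Longrightarrow> a h \<bullet> v = b h \<Longrightarrow> a h \<bullet> w \<le> 0"
  shows "\<forall>\<^sub>F t in at_right 0. \<forall>h\<in>H. a h \<bullet> (v + t *\<^sub>R w) \<le> b h"
  unfolding eventually_ball_finite_distrib[OF \<open>finite H\<close>]
proof
  fix h assume h: "h \<in> H"
  show "\<forall>\<^sub>F t in at_right 0. a h \<bullet> (v + t *\<^sub>R w) \<le> b h"
  proof (cases "a h \<bullet> v = b h")
    case True
    then show ?thesis
      using w[OF h True] eventually_at_right_less[of "0::real"]
      by (auto elim!: eventually_mono simp: inner_add_right mult_nonneg_nonpos)
  next
    case False
    have "((\<lambda>t. a h \<bullet> (v + t *\<^sub>R w)) \<longlongrightarrow> a h \<bullet> (v + 0 *\<^sub>R w)) (at_right 0)"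
      by (intro tendsto_intros)
    then have "\<forall>\<^sub>F t in at_right 0. a h \<bullet> (v + t *\<^sub>R w) < b h"
      by (rule order_tendstoD) (use v[OF h] False in auto)
    then show ?thesis
      by (rule eventually_mono) simp
  qed
qed

text \<open>The generators are the inner normals of the inequalities tight at \<open>v\<close>.
  Simplicity counts them, extremality of \<open>v\<close> makes them span, and moving from
  \<open>v\<close> along dual basis directions shows that they generate the normal cone.\<close>

lemma simple_polytope_vertex_cone:
  fixes P :: "(real^'d) set"
  assumes P: "full_dim_simple_polytope P" and v: "v extreme_point_of P"
  obtains S where "independent S" "card S = CARD('d)" "inner_normal_cone P {v} = convex_cone hull S"
    "\<And>s. s \<in> S \<Longrightarrow> convex_cone hull {s} \<in> normal_fan P"
proof -
  have dimP: "aff_dim P = int CARD('d)"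
    using P by (simp add: full_dim_simple_polytope_def)
  then have "affine hull P = UNIV"
    by (simp add: aff_dim_eq_full[symmetric])
  moreover have "polyhedron P"
    using P by (simp add: full_dim_simple_polytope_def polytope_imp_polyhedron)
  \<comment> \<open>An irredundant description is chosen so that its half-spaces cut out exactly the
    facets.\<close>
  ultimately obtain H where H: "finite H" "P = \<Inter>H" "\<forall>h\<in>H. \<exists>a b. a \<noteq> 0 \<and> h = {x. a \<bullet> x \<le> b}"
      "\<And>H'. H' \<subset> H \<Longrightarrow> P \<subset> \<Inter>H'"
    unfolding polyhedron_Int_affine_minimal by auto
  obtain a b where ab: "\<And>h. h \<in> H \<Longrightarrow> a h \<noteq> 0 \<and> h = {x. a h \<bullet> x \<le> b h}"
    using bchoice[OF H(3)] by metis
  have facet: "C facet_of P \<longleftrightarrow> (\<exists>h. h \<in> H \<and> C = P \<inter> {x. a h \<bullet> x = b h})" for C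
    using facet_of_polyhedron_explicit[OF H(1) _ ab, of P C] H \<open>affine hull P = UNIV\<close> by simp
  have in_P: "x \<in> P \<longleftrightarrow> (\<forall>h\<in>H. a h \<bullet> x \<le> b h)" for x
    using ab unfolding H(2) by auto
  have "v \<in> P"
    using v by (simp add: extreme_point_of_def)
  define T where "T = {h \<in> H. a h \<bullet> v = b h}"
  define \<Phi> where "\<Phi> h = P \<inter> {x. a h \<bullet> x = b h}" for h
  define S where "S = (\<lambda>h. - a h) ` T"
  have cone: "inner_normal_cone P (\<Phi> h) = convex_cone hull {- a h}" if "h \<in> H" for h
  proof (rule inner_normal_cone_facet[OF dimP])
    show "\<Phi> h facet_of P"
      using that facet by (auto simp: \<Phi>_def)
    show "a h \<noteq> 0" "P \<subseteq> {x. a h \<bullet> x \<le> b h}"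
      using that ab in_P by blast+
  qed (simp add: \<Phi>_def)
  \<comment> \<open>Both boundary hyperplanes pass through \<open>v\<close>, so proportional normals
    force proportional right-hand sides.\<close>
  have half_eq: "h = h'" if "h \<in> T" "h' \<in> T" "a h' = c *\<^sub>R a h" "0 \<le> c" for h h' c
  proof -
    have "0 < c"
      using that ab[of h'] by (cases "c = 0") (auto simp: T_def)
    moreover have "b h' = c * b h"
      using that by (auto simp: T_def)
    ultimately have "{x. a h \<bullet> x \<le> b h} = {x. a h' \<bullet> x \<le> b h'}"
      using that by auto
    then show ?thesis
      using that ab[of h] ab[of h'] by (auto simp: T_def)
  qed
  have "bij_betw \<Phi> T {C. C facet_of P \<and> v \<in> C}"
    unfolding bij_betw_def
  proof
    show "inj_on \<Phi> T"
    proof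
      fix h h' assume h: "h \<in> T" "h' \<in> T" "\<Phi> h = \<Phi> h'"
      then have "convex_cone hull {- a h} = convex_cone hull {- a h'}"
        using cone[of h] cone[of h'] by (simp add: T_def)
      then have "- a h' \<in> convex_cone hull {- a h}"
        by (simp add: hull_inc)
      then show "h = h'"
        using half_eq[OF h(1,2)] by (auto simp: convex_cone_hull_singleton)
    qed
    show "\<Phi> ` T = {C. C facet_of P \<and> v \<in> C}"
      using \<open>v \<in> P\<close> by (auto simp: facet \<Phi>_def T_def)
  qed
  then have "card T = CARD('d)"
    using P v by (auto simp: full_dim_simple_polytope_def dest: bij_betw_same_card)
  moreover have "inj_on (\<lambda>h. - a h) T"
    using half_eq[where c = 1] by (auto simp: inj_on_def)
  ultimately have cardS: "card S = CARD('d)"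
    by (simp add: S_def card_image)
  \<comment> \<open>An infinite set has \<open>card\<close> 0, whereas \<open>CARD('d)\<close> is
    positive.\<close>
  then have "finite S"
    by (metis card.infinite card_0_eq finite UNIV_not_empty)
  have feasible: "\<forall>\<^sub>F t in at_right 0. v + t *\<^sub>R w \<in> P" if "\<And>s. s \<in> S \<Longrightarrow> 0 \<le> s \<bullet> w" for w
    unfolding in_P
  proof (rule eventually_feasible_direction[OF H(1)])
    fix h assume h: "h \<in> H"
    show "a h \<bullet> v \<le> b h"
      using h \<open>v \<in> P\<close> in_P by blast
    show "a h \<bullet> w \<le> 0" if "a h \<bullet> v = b h"
      using h \<open>\<And>s. s \<in> S \<Longrightarrow> 0 \<le> s \<bullet> w\<close>[of "- a h"] that by (simp add: S_def T_def)
  qed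
  have "dim S = CARD('d)"
  proof (rule ccontr)
    assume "dim S \<noteq> CARD('d)"
    then have "dim S < DIM(real^'d)"
      using dim_subset_UNIV[of S] by simp
    \<comment> \<open>A direction orthogonal to all tight normals is feasible together with its
      negative, placing \<open>v\<close> inside a segment in \<open>P\<close>.\<close>
    then obtain w where w: "w \<noteq> 0" "\<And>s. s \<in> span S \<Longrightarrow> orthogonal w s"
      using orthogonal_to_subspace_exists by blast
    then have "s \<bullet> w = 0" if "s \<in> S" for s
      using that by (metis orthogonal_def inner_commute span_base)
    then have "\<forall>\<^sub>F t in at_right 0. v + t *\<^sub>R w \<in> P \<and> v + t *\<^sub>R (- w) \<in> P \<and> 0 < t"
      by (intro eventually_conj feasible eventually_at_right_less) auto
    then obtain t :: real where t: "v + t *\<^sub>R w \<in> P" "v + t *\<^sub>R (- w) \<in> P" "0 < t"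
      using eventually_happens'[OF trivial_limit_at_right_real] by blast
    have "v \<in> open_segment (v + t *\<^sub>R w) (v + t *\<^sub>R (- w))"
    proof -
      have "(v + t *\<^sub>R w) - (v + t *\<^sub>R (- w)) = (t + t) *\<^sub>R w"
        by (simp add: vec_eq_iff)
      then have "v + t *\<^sub>R w \<noteq> v + t *\<^sub>R (- w)"
        using t(3) w(1) by auto
      moreover have "midpoint (v + t *\<^sub>R w) (v + t *\<^sub>R (- w)) = v"
        by (simp add: midpoint_def scaleR_half_double)
      ultimately show ?thesis
        by (metis midpoint_in_open_segment)
    qed
    then show False
      using v t by (auto simp: extreme_point_of_def)
  qed
  then have spanS: "span S = UNIV"
    by (simp add: dim_eq_full[symmetric])
  then have indep: "independent S"
    using cardS \<open>finite S\<close> by (intro card_le_dim_spanning[of S UNIV]) auto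
  have "inner_normal_cone P {v} = convex_cone hull S"
  proof
    show "convex_cone hull S \<subseteq> inner_normal_cone P {v}"
      by (intro hull_minimal convex_cone_inner_normal_cone) (auto simp: inner_normal_cone_def S_def T_def in_P)
    show "inner_normal_cone P {v} \<subseteq> convex_cone hull S"
    proof
      fix y assume y: "y \<in> inner_normal_cone P {v}"
      have "0 \<le> representation S y s" if s: "s \<in> S" for s
      proof -
        have "card (S - {s}) < card S"
          using s \<open>finite S\<close> by (rule card_Diff1_less[rotated])
        then have "dim (S - {s}) < DIM(real^'d)"
          using dim_le_card'[of "S - {s}"] \<open>finite S\<close> cardS by simp
        \<comment> \<open>The other generators are too few to span, so some nonzero \<open>u\<close>
          is orthogonal to all of them; pairing with \<open>u\<close> then isolates the coordinate
          at \<open>s\<close>.\<close>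
        then obtain u where u: "u \<noteq> 0" "\<And>r. r \<in> span (S - {s}) \<Longrightarrow> orthogonal u r"
          using orthogonal_to_subspace_exists by blast
        then have ortho: "r \<bullet> u = 0" if "r \<in> S - {s}" for r
          using that by (metis orthogonal_def inner_commute span_base)
        have inner_u: "x \<bullet> u = representation S x s * (s \<bullet> u)" for x
        proof -
          have "x \<bullet> u = (\<Sum>r\<in>S. representation S x r *\<^sub>R r) \<bullet> u"
            using real_vector.sum_representation_eq[OF indep, of x S] \<open>finite S\<close> spanS by simp
          also have "\<dots> = (\<Sum>r\<in>{s}. representation S x r * (r \<bullet> u))"
            unfolding inner_sum_left inner_scaleR_left
            using s ortho \<open>finite S\<close> by (intro sum.mono_neutral_right) auto
          finally show ?thesis
            by simp
        qed
        have "s \<bullet> u \<noteq> 0"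
          using inner_u[of u] \<open>u \<noteq> 0\<close> by auto
        \<comment> \<open>a positive multiple of the dual basis vector of \<open>s\<close>\<close>
        define w where "w = (s \<bullet> u) *\<^sub>R u"
        have "\<forall>\<^sub>F t in at_right 0. v + t *\<^sub>R w \<in> P \<and> 0 < t"
          using ortho by (intro eventually_conj feasible eventually_at_right_less) (force simp: w_def)
        then obtain t :: real where t: "v + t *\<^sub>R w \<in> P" "0 < t"
          using eventually_happens'[OF trivial_limit_at_right_real] by blast
        \<comment> \<open>Since \<open>y\<close> attains its minimum over \<open>P\<close> at
          \<open>v\<close>, it cannot decrease along the feasible direction
          \<open>w\<close>.\<close>
        have "y \<bullet> v \<le> y \<bullet> (v + t *\<^sub>R w)"
          using y t by (simp add: inner_normal_cone_def)
        then have "0 \<le> y \<bullet> w"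
          using t by (simp add: inner_add_right zero_le_mult_iff)
        also have "\<dots> = representation S y s * (s \<bullet> u)\<^sup>2"
          by (simp add: w_def inner_u[of y] power2_eq_square)
        finally show ?thesis
          using \<open>s \<bullet> u \<noteq> 0\<close> by (simp add: zero_le_mult_iff)
      qed
      then show "y \<in> convex_cone hull S"
        by (simp add: convex_cone_hull_independent[OF indep] spanS)
    qed
  qed
  moreover have "convex_cone hull {s} \<in> normal_fan P" if s: "s \<in> S" for s
  proof -
    obtain h where h: "h \<in> H" "h \<in> T" "s = - a h"
      using s by (auto simp: S_def T_def)
    have "\<Phi> h face_of P" "\<Phi> h \<noteq> {}"
      using h facet[of "\<Phi> h"] by (auto simp: \<Phi>_def facet_of_def)
    then show ?thesis
      using cone[OF h(1)] h(3) unfolding normal_fan_def by blast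
  qed
  ultimately show thesis
    using that indep cardS by blast
qed

text \<open>A full-dimensional normal cone belongs to a vertex: two distinct points of
  \<open>F\<close> would confine the cone to the hyperplane orthogonal to their difference. The
  description of vertex cones then applies.\<close>

lemma normal_fan_card_ray_indices:
  fixes P :: "(real^'d) set" and U :: "real^'d^'n"
  assumes P: "full_dim_simple_polytope P" and U: "is_ray_matrix (normal_fan P) U"
    and \<sigma>: "\<sigma> \<in> cones_of_dim (normal_fan P) CARD('d)"
  shows "card (ray_indices U \<sigma>) = CARD('d)"
proof -
  obtain F where F: "F face_of P" "F \<noteq> {}" "\<sigma> = inner_normal_cone P F" "dim \<sigma> = CARD('d)"
    using \<sigma> by (auto simp: cones_of_dim_def normal_fan_def)
  have "p = q" if pq: "p \<in> F" "q \<in> F" for p q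
  proof (rule ccontr)
    assume "p \<noteq> q"
    have "p \<in> P" "q \<in> P"
      using pq F face_of_imp_subset by blast+
    then have "y \<bullet> p = y \<bullet> q" if "y \<in> \<sigma>" for y
      using that pq F(3) by (intro antisym) (auto simp: inner_normal_cone_def)
    then have "\<sigma> \<subseteq> {y. (p - q) \<bullet> y = 0}"
      by (auto simp: inner_diff_right inner_commute[of "p - q"])
    then have "dim \<sigma> \<le> dim {y. (p - q) \<bullet> y = 0}"
      by (rule dim_subset)
    moreover have "dim {y. (p - q) \<bullet> y = 0} = CARD('d) - 1"
      using \<open>p \<noteq> q\<close> by (simp add: dim_hyperplane)
    \<comment> \<open>Positivity makes the truncated subtraction a genuine decrease.\<close>
    moreover have "0 < CARD('d)"
      by simp
    ultimately show False
      using F(4) by linarith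
  qed
  then obtain v where "F = {v}"
    using F by blast
  then have "v extreme_point_of P"
    using F by (simp add: face_of_singleton)
  then obtain S where "independent S" "card S = CARD('d)" "\<sigma> = convex_cone hull S"
      "\<And>s. s \<in> S \<Longrightarrow> convex_cone hull {s} \<in> normal_fan P"
    using simple_polytope_vertex_cone[OF P] F \<open>F = {v}\<close> by metis
  then show ?thesis
    using U card_ray_indices_simplicial[of S "normal_fan P" U] by (simp add: is_ray_matrix_def)
qed

section \<open>The product formulas for fans and polytopes\<close>

theorem lemma3p2:
  fixes U\<^sub>1 :: "real^'d1^'n1" and U\<^sub>2 :: "real^'d2^'n2"
  shows
    "(\<forall>\<Sigma>\<^sub>1 \<Sigma>\<^sub>2.
        simplicial_fan \<Sigma>\<^sub>1 \<and> is_ray_matrix \<Sigma>\<^sub>1 U\<^sub>1 \<and>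
        simplicial_fan \<Sigma>\<^sub>2 \<and> is_ray_matrix \<Sigma>\<^sub>2 U\<^sub>2 \<longrightarrow>
        (\<forall>x :: 'n1 + 'n2 \<Rightarrow> 'k::real_field.
           Amp (prod_fan \<Sigma>\<^sub>1 \<Sigma>\<^sub>2) (block_diag U\<^sub>1 U\<^sub>2) x =
             Amp \<Sigma>\<^sub>1 U\<^sub>1 (\<lambda>i. x (Inl i)) * Amp \<Sigma>\<^sub>2 U\<^sub>2 (\<lambda>j. x (Inr j)) \<and>
           Adj (prod_fan \<Sigma>\<^sub>1 \<Sigma>\<^sub>2) (block_diag U\<^sub>1 U\<^sub>2) x =
             Adj \<Sigma>\<^sub>1 U\<^sub>1 (\<lambda>i. x (Inl i)) * Adj \<Sigma>\<^sub>2 U\<^sub>2 (\<lambda>j. x (Inr j)))) \<and>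
     (\<forall>P\<^sub>1 P\<^sub>2.
        full_dim_simple_polytope P\<^sub>1 \<and> is_ray_matrix (normal_fan P\<^sub>1) U\<^sub>1 \<and>
        full_dim_simple_polytope P\<^sub>2 \<and> is_ray_matrix (normal_fan P\<^sub>2) U\<^sub>2 \<longrightarrow>
        (\<forall>x :: 'n1 + 'n2 \<Rightarrow> 'k::real_field.
           polytope_Amp (prod_set P\<^sub>1 P\<^sub>2) (block_diag U\<^sub>1 U\<^sub>2) x =
             polytope_Amp P\<^sub>1 U\<^sub>1 (\<lambda>i. x (Inl i)) * polytope_Amp P\<^sub>2 U\<^sub>2 (\<lambda>j. x (Inr j)) \<and>
           polytope_Adj (prod_set P\<^sub>1 P\<^sub>2) (block_diag U\<^sub>1 U\<^sub>2) x =
             polytope_Adj P\<^sub>1 U\<^sub>1 (\<lambda>i. x (Inl i)) * polytope_Adj P\<^sub>2 U\<^sub>2 (\<lambda>j. x (Inr j))))"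
proof (intro conjI allI impI; elim conjE)
  fix \<Sigma>\<^sub>1 :: "(real^'d1) set set" and \<Sigma>\<^sub>2 :: "(real^'d2) set set" and x :: "'n1 + 'n2 \<Rightarrow> 'k"
  assume *: "simplicial_fan \<Sigma>\<^sub>1" "is_ray_matrix \<Sigma>\<^sub>1 U\<^sub>1" "simplicial_fan \<Sigma>\<^sub>2" "is_ray_matrix \<Sigma>\<^sub>2 U\<^sub>2"
  show "Amp (prod_fan \<Sigma>\<^sub>1 \<Sigma>\<^sub>2) (block_diag U\<^sub>1 U\<^sub>2) x =
      Amp \<Sigma>\<^sub>1 U\<^sub>1 (\<lambda>i. x (Inl i)) * Amp \<Sigma>\<^sub>2 U\<^sub>2 (\<lambda>j. x (Inr j))"
    using * by (intro Amp_Adj_prod_fan ballI simplicial_fan_pointed simplicial_fan_card_ray_indices)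
  show "Adj (prod_fan \<Sigma>\<^sub>1 \<Sigma>\<^sub>2) (block_diag U\<^sub>1 U\<^sub>2) x =
      Adj \<Sigma>\<^sub>1 U\<^sub>1 (\<lambda>i. x (Inl i)) * Adj \<Sigma>\<^sub>2 U\<^sub>2 (\<lambda>j. x (Inr j))"
    using * by (intro Amp_Adj_prod_fan ballI simplicial_fan_pointed simplicial_fan_card_ray_indices)
next
  fix P\<^sub>1 :: "(real^'d1) set" and P\<^sub>2 :: "(real^'d2) set" and x :: "'n1 + 'n2 \<Rightarrow> 'k"
  assume *: "full_dim_simple_polytope P\<^sub>1" "is_ray_matrix (normal_fan P\<^sub>1) U\<^sub>1"
    "full_dim_simple_polytope P\<^sub>2" "is_ray_matrix (normal_fan P\<^sub>2) U\<^sub>2"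
  then have dims: "aff_dim P\<^sub>1 = int CARD('d1)" "aff_dim P\<^sub>2 = int CARD('d2)"
    by (simp_all add: full_dim_simple_polytope_def)
  \<comment> \<open>Rewriting the normal fan as a product fan reduces to the common core; full
    dimension gives pointedness and simplicity gives the ray count.\<close>
  show "polytope_Amp (prod_set P\<^sub>1 P\<^sub>2) (block_diag U\<^sub>1 U\<^sub>2) x =
      polytope_Amp P\<^sub>1 U\<^sub>1 (\<lambda>i. x (Inl i)) * polytope_Amp P\<^sub>2 U\<^sub>2 (\<lambda>j. x (Inr j))"
    unfolding polytope_Amp_def normal_fan_prod_set using * dims
    by (intro Amp_Adj_prod_fan ballI normal_fan_pointed normal_fan_card_ray_indices)
  show "polytope_Adj (prod_set P\<^sub>1 P\<^sub>2) (block_diag U\<^sub>1 U\<^sub>2) x =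
      polytope_Adj P\<^sub>1 U\<^sub>1 (\<lambda>i. x (Inl i)) * polytope_Adj P\<^sub>2 U\<^sub>2 (\<lambda>j. x (Inr j))"
    unfolding polytope_Adj_def normal_fan_prod_set using * dims
    by (intro Amp_Adj_prod_fan ballI normal_fan_pointed normal_fan_card_ray_indices)
qed

end
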